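(* Let $\Omega=\prod_{k=1}^n\Omega_k$ with product probability measure $\mu=\bigotimes_{k=1}^n\mu_k$, and let $f$ be a bounded measurable real function on $\Omega$. Assume $f-E_k[f]\le1$ for all $k\in\{1,\ldots,n\}$. Let $t>0$ and denote $V=\Vert\Sigma^2(f)\Vert_\infty$. Then $$\Pr\{f-E[f]>t\}\le\exp\Bigl(-V\bigl((1+tV^{-1})\ln(1+tV^{-1})-tV^{-1}\bigr)\Bigr)\le\exp\left(\frac{-t^2}{2V+2t/3}\right).$$
   Context: $E[g]=\int_\Omega g\,\mathrm{d}\mu$, $\Pr$ is probability under $\mu$, and $\Vert\cdot\Vert_\infty$ is the norm of $L_\infty[\mu]$. For $\mathbf{x}\in\Omega$ and $y\in\Omega_k$, $\mathbf{x}_{y,k}$ denotes $\mathbf{x}$ with its $k$th coordinate replaced by $y$. Then $E_k[g](\mathbf{x})=\int_{\Omega_k}g(\mathbf{x}_{y,k})\,\mathrm{d}\mu_k(y)$, the conditional variance is $\sigma_k^2(g)=E_k\bigl[(g-E_k[g])^2\bigr]$, and $\Sigma^2(f)=\sum_{k=1}^n\sigma_k^2(f)$. If $V=0$ the middle expression is read as $0$ (its limit as $V\downarrow0$). *)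

theory Defs
  imports "HOL-Probability.Probability" "HOL-Probability.Essential_Supremum"
begin

text \<open>
  The spaces \<open>\<Omega>\<^sub>k\<close> with their measures \<open>\<mu>\<^sub>k\<close> are given by a family \<open>M :: nat \<Rightarrow> 'a measure\<close>; points of
  the product are the extensional functions in \<open>space (Pi\<^sub>M {1..n} M)\<close>, so that replacing the
  \<open>k\<close>th coordinate of \<open>x\<close> by \<open>y\<close> is the function update \<open>x(k := y)\<close>.
\<close>

definition cond_mean :: "(nat \<Rightarrow> 'a measure) \<Rightarrow> nat \<Rightarrow> ((nat \<Rightarrow> 'a) \<Rightarrow> real) \<Rightarrow> (nat \<Rightarrow> 'a) \<Rightarrow> real"
  where "cond_mean M k g x = (\<integral>y. g (x(k := y)) \<partial>M k)"

definition cond_var :: "(nat \<Rightarrow> 'a measure) \<Rightarrow> nat \<Rightarrow> ((nat \<Rightarrow> 'a) \<Rightarrow> real) \<Rightarrow> (nat \<Rightarrow> 'a) \<Rightarrow> real"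
  where "cond_var M k g = cond_mean M k (\<lambda>x. (g x - cond_mean M k g x)\<^sup>2)"

definition sum_cond_var :: "(nat \<Rightarrow> 'a measure) \<Rightarrow> nat \<Rightarrow> ((nat \<Rightarrow> 'a) \<Rightarrow> real) \<Rightarrow> (nat \<Rightarrow> 'a) \<Rightarrow> real"
  where "sum_cond_var M n g x = (\<Sum>k = 1..n. cond_var M k g x)"

text \<open>
  The norm of \<open>L\<^sub>\<infinity>\<close>. The library's \<^const>\<open>esssup\<close> needs a complete linear order, hence the
  detour through \<^typ>\<open>ereal\<close>; the value is meaningful for essentially bounded measurable \<open>g\<close>.
\<close>

definition Linf_norm :: "'b measure \<Rightarrow> ('b \<Rightarrow> real) \<Rightarrow> real"
  where "Linf_norm N g = real_of_ereal (esssup N (\<lambda>x. ereal \<bar>g x\<bar>))"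

end

(* The entropy method. Write F(b) = E[exp(b f)] and D(g, c) = g ln(g/c) - g + c. Induction on the number
   of coordinates gives Ent(g) <= sum_k E[D(g, c_k)] for every choice of positive c_k not depending on
   the k-th coordinate. Take g = exp(b f) and c_k = exp(b E_k[f]). Since f - E_k[f] <= 1, the function
   phi(b) = b exp(b) - exp(b) + 1 satisfies D(g, c_k) <= c_k (f - E_k[f])^2 phi(b), and c_k <= E_k[g] by
   Jensen, so that b F'(b) - F(b) ln F(b) <= V phi(b) F(b). As phi(b)/b^2 is the derivative of
   (exp(b) - 1)/b, integrating yields ln E[exp(b (f - E f))] <= V (exp(b) - 1 - b), and the Chernoff
   bound with b = ln(1 + t/V) finishes the proof (b tends to infinity if V = 0). *)
theory Submission
  imports Defs "HOL-Real_Asymp.Real_Asymp"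
begin

section \<open>Bounded measurable functions\<close>

text \<open>The bound is required at every point and not just almost everywhere, so that it passes
  to every section obtained by fixing coordinates.\<close>

definition bdd_meas :: "'b measure \<Rightarrow> ('b \<Rightarrow> real) \<Rightarrow> bool"
  where "bdd_meas N f \<longleftrightarrow> f \<in> borel_measurable N \<and> (\<exists>B. \<forall>x\<in>space N. \<bar>f x\<bar> \<le> B)"

lemma bdd_measD: "bdd_meas N f \<Longrightarrow> f \<in> borel_measurable N"
  by (simp add: bdd_meas_def)

lemma bdd_measE:
  assumes "bdd_meas N f"
  obtains B where "B > 0" "\<And>x. x \<in> space N \<Longrightarrow> \<bar>f x\<bar> \<le> B"
proof -
  obtain B where B: "\<forall>x\<in>space N. \<bar>f x\<bar> \<le> B"
    using assms by (auto simp: bdd_meas_def)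
  show ?thesis
    by (rule that[of "max B 1"]) (use B in \<open>auto simp: le_max_iff_disj\<close>)
qed

lemma bdd_measI: "f \<in> borel_measurable N \<Longrightarrow> (\<And>x. x \<in> space N \<Longrightarrow> \<bar>f x\<bar> \<le> B) \<Longrightarrow> bdd_meas N f"
  by (auto simp: bdd_meas_def)

lemma bdd_meas_const: "bdd_meas N (\<lambda>x. c)"
  by (auto simp: bdd_meas_def)

lemma bdd_meas_add:
  assumes "bdd_meas N f" "bdd_meas N g"
  shows "bdd_meas N (\<lambda>x. f x + g x)"
proof -
  obtain A where "A > 0" "\<And>x. x \<in> space N \<Longrightarrow> \<bar>f x\<bar> \<le> A"
    using assms(1) by (rule bdd_measE) blast
  moreover obtain B where "\<And>x. x \<in> space N \<Longrightarrow> \<bar>g x\<bar> \<le> B"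
    using assms(2) by (rule bdd_measE) blast
  ultimately show ?thesis
    using assms[THEN bdd_measD]
    by (intro bdd_measI[where B = "A + B"]) (auto intro: order_trans[OF abs_triangle_ineq] add_mono)
qed

lemma bdd_meas_mult:
  assumes "bdd_meas N f" "bdd_meas N g"
  shows "bdd_meas N (\<lambda>x. f x * g x)"
proof -
  obtain A where "A > 0" "\<And>x. x \<in> space N \<Longrightarrow> \<bar>f x\<bar> \<le> A"
    using assms(1) by (rule bdd_measE) blast
  moreover obtain B where "\<And>x. x \<in> space N \<Longrightarrow> \<bar>g x\<bar> \<le> B"
    using assms(2) by (rule bdd_measE) blast
  ultimately show ?thesis
    using assms[THEN bdd_measD]
    by (intro bdd_measI[where B = "A * B"]) (auto simp: abs_mult intro!: mult_mono)
qed

lemma bdd_meas_diff: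
  assumes "bdd_meas N f" "bdd_meas N g"
  shows "bdd_meas N (\<lambda>x. f x - g x)"
  using bdd_meas_add[OF assms(1) bdd_meas_mult[OF bdd_meas_const[of N "-1"] assms(2)]] by simp

lemma bdd_meas_power: "bdd_meas N f \<Longrightarrow> bdd_meas N (\<lambda>x. (f x)\<^sup>2)"
  using bdd_meas_mult[of N f f] by (simp add: power2_eq_square)

lemma bdd_meas_sum: "(\<And>k. k \<in> A \<Longrightarrow> bdd_meas N (f k)) \<Longrightarrow> bdd_meas N (\<lambda>x. \<Sum>k\<in>A. f k x)"
  by (induction A rule: infinite_finite_induct) (simp_all add: bdd_meas_add bdd_meas_const)

lemma bdd_meas_exp:
  assumes "bdd_meas N f"
  shows "bdd_meas N (\<lambda>x. exp (f x))"
proof -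
  obtain A where A: "\<And>x. x \<in> space N \<Longrightarrow> \<bar>f x\<bar> \<le> A"
    using assms by (rule bdd_measE) blast
  have "f x \<le> A" if "x \<in> space N" for x
    using A[OF that] by simp
  then show ?thesis
    using assms[THEN bdd_measD] by (intro bdd_measI[where B = "exp A"]) auto
qed

lemmas bdd_meas_simps = bdd_meas_const bdd_meas_add bdd_meas_mult bdd_meas_diff bdd_meas_power
  bdd_meas_sum bdd_meas_exp

lemma bdd_meas_compose: "bdd_meas N f \<Longrightarrow> h \<in> measurable L N \<Longrightarrow> bdd_meas L (\<lambda>x. f (h x))"
  unfolding bdd_meas_def by (auto intro: measurable_compose dest: measurable_space)

lemma (in finite_measure) bdd_meas_integrable: "bdd_meas M f \<Longrightarrow> integrable M f"
  unfolding bdd_meas_def by (metis AE_I2 integrable_const_bound real_norm_def)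

text \<open>A lower bound \<open>- B\<close> on \<open>f\<close> keeps the mean above
  \<open>exp (- B)\<close>. Logarithms of such means are therefore taken only at positive
  arguments.\<close>

lemma (in prob_space) bdd_meas_expectation_exp_pos:
  assumes "bdd_meas M f"
  shows "expectation (\<lambda>x. exp (f x)) > 0"
proof -
  obtain B where B: "\<And>x. x \<in> space M \<Longrightarrow> \<bar>f x\<bar> \<le> B"
    using assms by (rule bdd_measE) blast
  have "expectation (\<lambda>x. exp (f x)) \<ge> exp (- B)"
    using B by (intro integral_ge_const bdd_meas_integrable AE_I2) (auto simp: assms abs_le_iff bdd_meas_exp minus_le_iff)
  then show ?thesis
    using exp_gt_zero[of "- B"] by linarith
qed

lemma (in prob_space) bdd_meas_integral:
  assumes "bdd_meas (N \<Otimes>\<^sub>M M) (case_prod f)"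
  shows "bdd_meas N (\<lambda>x. \<integral>y. f x y \<partial>M)"
proof -
  obtain B where B: "\<And>z. z \<in> space (N \<Otimes>\<^sub>M M) \<Longrightarrow> \<bar>case_prod f z\<bar> \<le> B"
    using assms by (rule bdd_measE) blast
  show ?thesis
  proof (rule bdd_measI)
    show "(\<lambda>x. \<integral>y. f x y \<partial>M) \<in> borel_measurable N"
      using assms[THEN bdd_measD] by (rule borel_measurable_lebesgue_integral)
    fix x assume x: "x \<in> space N"
    have *: "bdd_meas M (f x)"
      using bdd_meas_compose[OF assms, of "\<lambda>y. (x, y)" M] x by simp
    have "\<And>y. y \<in> space M \<Longrightarrow> \<bar>f x y\<bar> \<le> B"
      using B x by (force simp: space_pair_measure)
    then show "\<bar>\<integral>y. f x y \<partial>M\<bar> \<le> B"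
      using * by (intro order_trans[OF integral_abs_bound] integral_le_const integrable_abs
          bdd_meas_integrable AE_I2)
  qed
qed

text \<open>The inner mean lies between \<open>exp (- B)\<close> and \<open>exp B\<close>, so its
  logarithm stays within \<open>B\<close> of zero. This makes the entropy of a marginal integrable
  in the induction on coordinates.\<close>

lemma (in prob_space) bdd_meas_ln_integral_exp:
  assumes "bdd_meas (N \<Otimes>\<^sub>M M) (case_prod f)"
  shows "bdd_meas N (\<lambda>x. ln (\<integral>y. exp (f x y) \<partial>M))"
proof -
  obtain B where B: "\<And>z. z \<in> space (N \<Otimes>\<^sub>M M) \<Longrightarrow> \<bar>case_prod f z\<bar> \<le> B"
    using assms by (rule bdd_measE) blast
  have E: "bdd_meas (N \<Otimes>\<^sub>M M) (\<lambda>(x, y). exp (f x y))"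
    using bdd_meas_exp[OF assms] by (simp add: case_prod_unfold)
  show ?thesis
  proof (rule bdd_measI)
    show "(\<lambda>x. ln (\<integral>y. exp (f x y) \<partial>M)) \<in> borel_measurable N"
      using bdd_meas_integral[OF E, THEN bdd_measD] by measurable
    fix x assume x: "x \<in> space N"
    have *: "bdd_meas M (f x)"
      using bdd_meas_compose[OF assms, of "\<lambda>y. (x, y)" M] x by simp
    have b: "\<bar>f x y\<bar> \<le> B" if "y \<in> space M" for y
      using B[of "(x, y)"] x that by (auto simp: space_pair_measure)
    have le: "expectation (\<lambda>y. exp (f x y)) \<le> exp B"
      using b by (intro integral_le_const bdd_meas_integrable AE_I2) (auto simp: * abs_le_iff bdd_meas_exp)
    have ge: "expectation (\<lambda>y. exp (f x y)) \<ge> exp (- B)"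
      using b by (intro integral_ge_const bdd_meas_integrable AE_I2) (auto simp: * abs_le_iff bdd_meas_exp minus_le_iff)
    have pos: "expectation (\<lambda>y. exp (f x y)) > 0"
      using * by (rule bdd_meas_expectation_exp_pos)
    show "\<bar>ln (\<integral>y. exp (f x y) \<partial>M)\<bar> \<le> B"
      using le ge pos by (metis abs_leI exp_le_cancel_iff exp_ln minus_le_iff)
  qed
qed

section \<open>Product spaces and subadditivity of entropy\<close>

context
  fixes M :: "'i \<Rightarrow> 'a measure"
  assumes prob: "\<And>i. prob_space (M i)"
begin

lemma prob_space_product: "prob_space (PiM I M)"
  using prob by (rule prob_space_PiM)

lemma product_sigma_finite_prob: "product_sigma_finite M"
  by (simp add: product_sigma_finite_def prob prob_space_imp_sigma_finite)

lemma bdd_meas_insert: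
  assumes "bdd_meas (PiM (insert i I) M) h"
  shows "bdd_meas (PiM I M \<Otimes>\<^sub>M M i) (\<lambda>(x, y). h (x(i := y)))"
    and "bdd_meas (M i \<Otimes>\<^sub>M PiM I M) (\<lambda>(y, x). h (x(i := y)))"
proof -
  show 1: "bdd_meas (PiM I M \<Otimes>\<^sub>M M i) (\<lambda>(x, y). h (x(i := y)))"
    using bdd_meas_compose[OF assms measurable_add_dim] by (simp add: case_prod_unfold)
  show "bdd_meas (M i \<Otimes>\<^sub>M PiM I M) (\<lambda>(y, x). h (x(i := y)))"
    using bdd_meas_compose[OF 1 measurable_pair_swap'] by (simp add: case_prod_unfold)
qed

lemma bdd_meas_section:
  assumes "bdd_meas (PiM (insert i I) M) h"
  shows "y \<in> space (M i) \<Longrightarrow> bdd_meas (PiM I M) (\<lambda>x. h (x(i := y)))"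
    and "x \<in> space (PiM I M) \<Longrightarrow> bdd_meas (M i) (\<lambda>y. h (x(i := y)))"
  using bdd_meas_compose[OF bdd_meas_insert(1)[OF assms], of "\<lambda>x. (x, y)" "PiM I M"]
    bdd_meas_compose[OF bdd_meas_insert(1)[OF assms], of "\<lambda>y. (x, y)" "M i"]
  by auto

lemma bdd_meas_integral_product:
  assumes "bdd_meas (PiM (insert i I) M) h"
  shows "bdd_meas (M i) (\<lambda>y. \<integral>x. h (x(i := y)) \<partial>PiM I M)"
  using prob_space.bdd_meas_integral[OF prob_space_product bdd_meas_insert(2)[OF assms]] .

text \<open>Fubini in both orders: integrating the new coordinate first serves conditional means,
  integrating it last serves the induction on the index set.\<close>

lemma integral_insert:
  assumes "finite I" "i \<notin> I" "bdd_meas (PiM (insert i I) M) h"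
  shows "(\<integral>x. h x \<partial>PiM (insert i I) M) = (\<integral>x. \<integral>y. h (x(i := y)) \<partial>M i \<partial>PiM I M)"
    and "(\<integral>x. h x \<partial>PiM (insert i I) M) = (\<integral>y. \<integral>x. h (x(i := y)) \<partial>PiM I M \<partial>M i)"
proof -
  interpret product_sigma_finite M by (rule product_sigma_finite_prob)
  interpret J: prob_space "PiM (insert i I) M" by (rule prob_space_product)
  interpret P: prob_space "PiM I M" by (rule prob_space_product)
  interpret Q: prob_space "M i" by (rule prob)
  interpret PQ: pair_prob_space "PiM I M" "M i" ..
  show 1: "(\<integral>x. h x \<partial>PiM (insert i I) M) = (\<integral>x. \<integral>y. h (x(i := y)) \<partial>M i \<partial>PiM I M)"
    using assms by (intro product_integral_insert J.bdd_meas_integrable)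
  show "(\<integral>x. h x \<partial>PiM (insert i I) M) = (\<integral>y. \<integral>x. h (x(i := y)) \<partial>PiM I M \<partial>M i)"
    unfolding 1
    by (rule PQ.Fubini_integral[symmetric]) (intro PQ.P.bdd_meas_integrable bdd_meas_insert assms)
qed

text \<open>
  Subadditivity of entropy in variational form: \<open>exp (w k)\<close> is a competitor for the
  \<open>k\<close>th conditional mean of \<open>exp u\<close>, and the choice of the true mean would turn the \<open>k\<close>th summand into
  the expected conditional entropy.
\<close>
lemma entropy_subadditive:
  fixes u :: "('i \<Rightarrow> 'a) \<Rightarrow> real"
  assumes "finite I" "bdd_meas (PiM I M) u"
    and "\<And>k. k \<in> I \<Longrightarrow> bdd_meas (PiM I M) (w k)"
    and "\<And>k x y. k \<in> I \<Longrightarrow> w k (x(k := y)) = w k x"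
  shows "(\<integral>x. exp (u x) * u x \<partial>PiM I M)
           - (\<integral>x. exp (u x) \<partial>PiM I M) * ln (\<integral>x. exp (u x) \<partial>PiM I M)
         \<le> (\<Sum>k\<in>I. \<integral>x. exp (u x) * (u x - w k x) - exp (u x) + exp (w k x) \<partial>PiM I M)"
  using assms
proof (induction I arbitrary: u w rule: finite_induct)
  case empty
  interpret product_sigma_finite M by (rule product_sigma_finite_prob)
  \<comment> \<open>The empty product is a single point, where the entropy of any function is
    zero.\<close>
  show ?case by (simp add: PiM_empty lebesgue_integral_count_space_finite)
next
  case (insert i I)
  interpret J: prob_space "PiM (insert i I) M" by (rule prob_space_product)
  interpret P: prob_space "PiM I M" by (rule prob_space_product)
  interpret Q: prob_space "M i" by (rule prob)
  note u = \<open>bdd_meas (PiM (insert i I) M) u\<close>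
  note w = \<open>\<And>k. k \<in> insert i I \<Longrightarrow> bdd_meas (PiM (insert i I) M) (w k)\<close>
  note inv = \<open>\<And>k x y. k \<in> insert i I \<Longrightarrow> w k (x(k := y)) = w k x\<close>
  note int = integral_insert(2)[OF \<open>finite I\<close> \<open>i \<notin> I\<close>]
  let ?D = "\<lambda>k x. exp (u x) * (u x - w k x) - exp (u x) + exp (w k x)"
  have D: "bdd_meas (PiM (insert i I) M) (?D k)" if "k \<in> insert i I" for k
    using u w[OF that] by (simp add: bdd_meas_simps)
  have eu: "bdd_meas (PiM (insert i I) M) (\<lambda>x. exp (u x) * u x)"
    using u by (simp add: bdd_meas_simps)
  have e: "bdd_meas (PiM (insert i I) M) (\<lambda>x. exp (u x))"
    using u by (simp add: bdd_meas_simps)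
  \<comment> \<open>\<open>A\<close> averages \<open>exp u\<close> over the old coordinates and
    \<open>Z\<close> is the mean of \<open>A\<close>. The entropy of \<open>exp u\<close> is the
    mean entropy of its sections plus the entropy of \<open>A\<close>; the induction hypothesis
    bounds the former by the terms with \<open>k\<close> in \<open>I\<close>, fact \<open>2\<close>
    bounds the latter by the term of \<open>i\<close>.\<close>
  define A where "A y = (\<integral>x. exp (u (x(i := y))) \<partial>PiM I M)" for y
  define Z where "Z = (\<integral>x. exp (u x) \<partial>PiM (insert i I) M)"
  have A: "bdd_meas (M i) A"
    using bdd_meas_integral_product[OF e] by (simp add: A_def[abs_def])
  have lnA: "bdd_meas (M i) (\<lambda>y. ln (A y))"
    unfolding A_def[abs_def] using bdd_meas_insert(2)[OF u] by (rule P.bdd_meas_ln_integral_exp)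
  have Apos: "A y > 0" if "y \<in> space (M i)" for y
    unfolding A_def using bdd_meas_section(1)[OF u that] by (rule P.bdd_meas_expectation_exp_pos)
  have Zpos: "Z > 0"
    unfolding Z_def using u by (rule J.bdd_meas_expectation_exp_pos)
  have ZA: "Z = (\<integral>y. A y \<partial>M i)"
    unfolding Z_def A_def by (rule int[OF e])
  have "(\<integral>y. (\<integral>x. exp (u (x(i := y))) * u (x(i := y)) \<partial>PiM I M) - A y * ln (A y) \<partial>M i)
      \<le> (\<integral>y. (\<Sum>k\<in>I. \<integral>x. ?D k (x(i := y)) \<partial>PiM I M) \<partial>M i)"
  proof (rule integral_mono)
    fix y assume y: "y \<in> space (M i)"
    show "(\<integral>x. exp (u (x(i := y))) * u (x(i := y)) \<partial>PiM I M) - A y * ln (A y)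
        \<le> (\<Sum>k\<in>I. \<integral>x. ?D k (x(i := y)) \<partial>PiM I M)"
      unfolding A_def
    proof (rule insert.IH)
      show "bdd_meas (PiM I M) (\<lambda>x. u (x(i := y)))"
        using u y by (rule bdd_meas_section(1))
      show "bdd_meas (PiM I M) (\<lambda>x. w k (x(i := y)))" if "k \<in> I" for k
        using w y that by (intro bdd_meas_section(1)) auto
      \<comment> \<open>Updates at the distinct indices \<open>k\<close> and \<open>i\<close>
        commute, so sections of \<open>w k\<close> are still independent of coordinate
        \<open>k\<close>.\<close>
      fix k x z assume "k \<in> I"
      with \<open>i \<notin> I\<close> have "k \<noteq> i" by auto
      then show "w k ((x(k := z))(i := y)) = w k (x(i := y))"
        using inv[of k "x(i := y)" z] \<open>k \<in> I\<close> by (simp add: fun_upd_twist)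
    qed
  next
    show "integrable (M i) (\<lambda>y. (\<integral>x. exp (u (x(i := y))) * u (x(i := y)) \<partial>PiM I M) - A y * ln (A y))"
      by (simp add: Q.bdd_meas_integrable bdd_meas_simps A lnA bdd_meas_integral_product[OF eu])
    show "integrable (M i) (\<lambda>y. \<Sum>k\<in>I. \<integral>x. ?D k (x(i := y)) \<partial>PiM I M)"
      by (simp add: Q.bdd_meas_integrable bdd_meas_sum bdd_meas_integral_product[OF D])
  qed
  also have "\<dots> = (\<Sum>k\<in>I. \<integral>y. \<integral>x. ?D k (x(i := y)) \<partial>PiM I M \<partial>M i)"
    by (simp add: Bochner_Integration.integral_sum Q.bdd_meas_integrable bdd_meas_integral_product[OF D])
  also have "\<dots> = (\<Sum>k\<in>I. \<integral>x. ?D k x \<partial>PiM (insert i I) M)"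
    by (intro sum.cong refl int[OF D, symmetric]) auto
  also have "(\<integral>y. (\<integral>x. exp (u (x(i := y))) * u (x(i := y)) \<partial>PiM I M) - A y * ln (A y) \<partial>M i)
      = (\<integral>x. exp (u x) * u x \<partial>PiM (insert i I) M) - (\<integral>y. A y * ln (A y) \<partial>M i)"
    unfolding int[OF eu]
    by (simp add: Q.bdd_meas_integrable bdd_meas_simps A lnA bdd_meas_integral_product[OF eu])
  finally have 1: "(\<integral>x. exp (u x) * u x \<partial>PiM (insert i I) M) - (\<integral>y. A y * ln (A y) \<partial>M i)
      \<le> (\<Sum>k\<in>I. \<integral>x. ?D k x \<partial>PiM (insert i I) M)" .

  have wi: "bdd_meas (PiM (insert i I) M) (w i)"
    using w by simp
  obtain y0 where y0: "y0 \<in> space (M i)"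
    using Q.not_empty by blast
  \<comment> \<open>As \<open>w i\<close> ignores coordinate \<open>i\<close>, freezing that
    coordinate at an arbitrary \<open>y0\<close> exhibits it as a function on the smaller
    product.\<close>
  have wi': "bdd_meas (PiM I M) (w i)"
    using bdd_meas_section(1)[OF wi y0] by (simp add: inv)
  define C where "C = (\<integral>x. exp (w i x) \<partial>PiM I M)"
  have C: "C = (\<integral>x. exp (w i x) \<partial>PiM (insert i I) M)"
    unfolding C_def int[OF bdd_meas_exp[OF wi]] by (simp add: inv Q.prob_space)
  have Di: "bdd_meas (PiM (insert i I) M) (\<lambda>x. exp (u x) * (u x - w i x))"
    using u wi by (simp add: bdd_meas_simps)
  have 2: "(\<integral>y. A y * ln (A y) \<partial>M i) - Z * ln Z \<le> (\<integral>x. ?D i x \<partial>PiM (insert i I) M)"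
  proof -
    have "(\<integral>y. A y * ln (A y) - A y * ln Z \<partial>M i)
       \<le> (\<integral>y. (\<integral>x. exp (u (x(i := y))) * (u (x(i := y)) - w i (x(i := y))) \<partial>PiM I M) - A y + A y / Z * C \<partial>M i)"
    proof (rule integral_mono)
      fix y assume y: "y \<in> space (M i)"
      have sec: "bdd_meas (PiM I M) (\<lambda>x. u (x(i := y)))"
        using u y by (rule bdd_meas_section(1))
      let ?U = "\<lambda>x. u (x(i := y))"
      have "(\<integral>x. exp (?U x) * (ln (A y) - ln Z) \<partial>PiM I M)
        \<le> (\<integral>x. exp (?U x) * (?U x - w i x) - exp (?U x) + A y / Z * exp (w i x) \<partial>PiM I M)"
      proof (rule integral_mono)
        fix x
        \<comment> \<open>This is the variational inequality for the competitor
          \<open>A y / Z * exp (w i x)\<close>: the tangent bound \<open>1 + z <= exp z\<close>,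
          multiplied by \<open>exp u\<close>. The factor \<open>A y / Z\<close> brings in the
          logarithm whose mean against \<open>A\<close> is the entropy of \<open>A\<close>.\<close>
        have "ln (A y / Z) + w i x - ?U x + 1 \<le> exp (ln (A y / Z) + w i x - ?U x)"
          using exp_ge_add_one_self[of "ln (A y / Z) + w i x - ?U x"] by linarith
        then have "exp (?U x) * (ln (A y / Z) + w i x - ?U x + 1) \<le> exp (?U x) * exp (ln (A y / Z) + w i x - ?U x)"
          by (rule mult_left_mono) simp
        also have "\<dots> = A y / Z * exp (w i x)"
          using Apos[OF y] Zpos by (simp add: exp_diff exp_add)
        finally show "exp (?U x) * (ln (A y) - ln Z)
            \<le> exp (?U x) * (?U x - w i x) - exp (?U x) + A y / Z * exp (w i x)"
          using Apos[OF y] Zpos by (simp add: ln_div algebra_simps)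
      qed (simp_all add: P.bdd_meas_integrable bdd_meas_simps sec wi')
      also have "\<dots> = (\<integral>x. exp (?U x) * (?U x - w i x) \<partial>PiM I M) - A y + A y / Z * C"
        unfolding A_def[of y, symmetric] C_def
        by (simp add: P.bdd_meas_integrable bdd_meas_simps sec wi' A_def)
      also have "(\<integral>x. exp (?U x) * (ln (A y) - ln Z) \<partial>PiM I M) = A y * ln (A y) - A y * ln Z"
        by (subst integral_mult_left_zero) (simp add: A_def algebra_simps)
      finally show "A y * ln (A y) - A y * ln Z
         \<le> (\<integral>x. exp (?U x) * (?U x - w i (x(i := y))) \<partial>PiM I M) - A y + A y / Z * C"
        by (simp only: inv insertI1)
    qed (simp_all add: Q.bdd_meas_integrable bdd_meas_simps A lnA
           bdd_meas_integral_product[OF Di] divide_inverse)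
    \<comment> \<open>Since \<open>A\<close> has mean \<open>Z\<close>, the factor
      \<open>A y / Z\<close> averages to 1 and the competitor is back to
      \<open>exp (w i x)\<close>.\<close>
    also have "\<dots> = (\<integral>x. exp (u x) * (u x - w i x) \<partial>PiM (insert i I) M) - Z + C"
      using Zpos
      by (simp add: Q.bdd_meas_integrable bdd_meas_simps divide_inverse A bdd_meas_integral_product[OF Di]
            int[OF Di] flip: ZA)
    also have "\<dots> = (\<integral>x. ?D i x \<partial>PiM (insert i I) M)"
      by (simp add: Z_def C J.bdd_meas_integrable e Di wi bdd_meas_exp bdd_meas_diff)
    also have "(\<integral>y. A y * ln (A y) - A y * ln Z \<partial>M i) = (\<integral>y. A y * ln (A y) \<partial>M i) - Z * ln Z"
      by (simp add: Q.bdd_meas_integrable A lnA bdd_meas_mult ZA)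
    finally show ?thesis .
  qed
  show ?case
    using 1 2 insert.hyps by (simp add: Z_def)
qed

end

section \<open>Bounding entropy by conditional variances\<close>

text \<open>Jensen's inequality, from the tangent line of \<open>exp\<close> at the mean.\<close>

lemma (in prob_space) exp_expectation_le:
  assumes "bdd_meas M X"
  shows "exp (expectation X) \<le> expectation (\<lambda>x. exp (X x))"
proof -
  let ?m = "expectation X"
  have "expectation (\<lambda>x. exp ?m * (1 + (X x - ?m))) \<le> expectation (\<lambda>x. exp (X x))"
  proof (rule integral_mono)
    show "exp ?m * (1 + (X x - ?m)) \<le> exp (X x)" for x
      using mult_left_mono[OF exp_ge_add_one_self[of "X x - ?m"], of "exp ?m"]
      by (simp flip: exp_add)
  qed (simp_all add: assms bdd_meas_integrable bdd_meas_simps)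
  then show ?thesis
    using assms by (simp add: bdd_meas_integrable bdd_meas_simps prob_space)
qed

lemma entropy_function_nonneg: "b * exp b - exp b + 1 \<ge> 0" for b :: real
  using mult_left_mono[OF exp_ge_add_one_self[of "-b"], of "exp b"]
  by (simp add: algebra_simps flip: exp_add)

text \<open>Both sides vanish at \<open>b = 0\<close>, and the derivative of their difference is
  \<open>x\<^sup>2 * (s * (exp s - exp (s * x)))\<close>, nonnegative because
  \<open>s * x <= s\<close>. No lower bound on \<open>x\<close> enters, which is why a one-sided
  assumption on \<open>f\<close> suffices.\<close>

lemma entropy_function_scaling:
  fixes b x :: real
  assumes "x \<le> 1" "0 \<le> b"
  shows "b * x * exp (b * x) - exp (b * x) + 1 \<le> x\<^sup>2 * (b * exp b - exp b + 1)"
proof -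
  define m where "m s = x\<^sup>2 * (s * exp s - exp s + 1) - (s * x * exp (s * x) - exp (s * x) + 1)" for s
  have "m 0 \<le> m b"
  proof (rule DERIV_nonneg_imp_nondecreasing[OF assms(2)])
    fix s assume s: "0 \<le> s" "s \<le> b"
    have "(m has_real_derivative x\<^sup>2 * (s * (exp s - exp (s * x)))) (at s)"
      unfolding m_def by (auto intro!: derivative_eq_intros simp: algebra_simps power2_eq_square)
    moreover have "s * x \<le> s"
      using mult_left_mono[OF assms(1) s(1)] by simp
    ultimately show "\<exists>y. (m has_real_derivative y) (at s) \<and> 0 \<le> y"
      using s by (intro exI[of _ "x\<^sup>2 * (s * (exp s - exp (s * x)))"]) auto
  qed
  then show ?thesis by (simp add: m_def)
qed

context
  fixes M :: "nat \<Rightarrow> 'a measure"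
  assumes prob: "\<And>i. prob_space (M i)"
begin

lemma cond_mean_upd [simp]: "cond_mean M k g (x(k := y)) = cond_mean M k g x"
  by (simp add: cond_mean_def)

lemma cond_var_upd [simp]: "cond_var M k g (x(k := y)) = cond_var M k g x"
  by (simp add: cond_var_def)

lemma cond_var_nonneg: "cond_var M k g x \<ge> 0"
  by (simp add: cond_var_def cond_mean_def)

text \<open>Here coordinate \<open>k\<close> is already present and gets overwritten; the insertion
  lemma applies because \<open>insert k I\<close> equals \<open>I\<close>.\<close>

lemma bdd_meas_upd:
  assumes "k \<in> I" "bdd_meas (PiM I M) h"
  shows "bdd_meas (PiM I M \<Otimes>\<^sub>M M k) (\<lambda>(x, y). h (x(k := y)))"
  using bdd_meas_insert(1)[OF prob, where I = I and i = k and h = h] assms by (simp add: insert_absorb)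

lemma bdd_meas_upd_section:
  assumes "k \<in> I" "bdd_meas (PiM I M) h" "x \<in> space (PiM I M)"
  shows "bdd_meas (M k) (\<lambda>y. h (x(k := y)))"
  using bdd_meas_compose[OF bdd_meas_upd[OF assms(1,2)], of "\<lambda>y. (x, y)" "M k"] assms(3) by simp

lemma bdd_meas_cond_mean:
  assumes "k \<in> I" "bdd_meas (PiM I M) h"
  shows "bdd_meas (PiM I M) (cond_mean M k h)"
  using prob_space.bdd_meas_integral[OF prob bdd_meas_upd[OF assms]]
  by (simp add: cond_mean_def[abs_def])

lemma bdd_meas_cond_var:
  assumes "k \<in> I" "bdd_meas (PiM I M) h"
  shows "bdd_meas (PiM I M) (cond_var M k h)"
  unfolding cond_var_def using assms by (simp add: bdd_meas_cond_mean bdd_meas_simps)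

text \<open>Tower property: once coordinate \<open>k\<close> is split off, the conditional mean is
  constant in it, and integrating a constant over a probability space changes nothing.\<close>

lemma integral_cond_mean:
  assumes "finite I" "k \<in> I" "bdd_meas (PiM I M) h"
  shows "(\<integral>x. cond_mean M k h x \<partial>PiM I M) = (\<integral>x. h x \<partial>PiM I M)"
proof -
  interpret Q: prob_space "M k" by (rule prob)
  define J where "J = I - {k}"
  have J: "finite J" "k \<notin> J" and I: "I = insert k J"
    using assms by (auto simp: J_def)
  note insert = integral_insert(1)[where M = M, OF prob J, folded I]
  have "(\<integral>x. cond_mean M k h x \<partial>PiM I M) = (\<integral>x. cond_mean M k h x \<partial>PiM J M)"
    using insert[OF bdd_meas_cond_mean[OF assms(2,3)]] by (simp add: Q.prob_space)
  also have "\<dots> = (\<integral>x. h x \<partial>PiM I M)"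
    using insert[OF assms(3)] by (simp add: cond_mean_def)
  finally show ?thesis .
qed

lemma entropy_le_cond_var:
  assumes "finite I" "bdd_meas (PiM I M) f"
    and le1: "\<And>k x. k \<in> I \<Longrightarrow> x \<in> space (PiM I M) \<Longrightarrow> f x - cond_mean M k f x \<le> 1"
    and b: "0 \<le> b"
  shows "(\<integral>x. exp (b * f x) * (b * f x) \<partial>PiM I M)
           - (\<integral>x. exp (b * f x) \<partial>PiM I M) * ln (\<integral>x. exp (b * f x) \<partial>PiM I M)
         \<le> (b * exp b - exp b + 1) * (\<integral>x. exp (b * f x) * (\<Sum>k\<in>I. cond_var M k f x) \<partial>PiM I M)"
proof -
  interpret P: prob_space "PiM I M" by (rule prob_space_PiM[OF prob])
  let ?phi = "b * exp b - exp b + 1"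
  let ?c = "\<lambda>k x. exp (b * cond_mean M k f x)"
  let ?D = "\<lambda>k x. exp (b * f x) * (b * f x - b * cond_mean M k f x) - exp (b * f x) + ?c k x"
  have phi: "?phi \<ge> 0"
    by (rule entropy_function_nonneg)
  note simps = bdd_meas_simps bdd_meas_cond_mean bdd_meas_cond_var assms(2) P.bdd_meas_integrable
  have k: "(\<integral>x. ?D k x \<partial>PiM I M) \<le> ?phi * (\<integral>x. exp (b * f x) * cond_var M k f x \<partial>PiM I M)"
    if k: "k \<in> I" for k
  proof -
    let ?d = "\<lambda>x. f x - cond_mean M k f x"
    have "(\<integral>x. ?D k x \<partial>PiM I M) \<le> (\<integral>x. ?phi * (?c k x * (?d x)\<^sup>2) \<partial>PiM I M)"
    proof (rule integral_mono)
      fix x assume x: "x \<in> space (PiM I M)"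
      \<comment> \<open>Factoring out the competitor leaves the entropy function of the deviation
        \<open>?d x\<close>, to which the scaling inequality applies.\<close>
      have "?D k x = ?c k x * (b * ?d x * exp (b * ?d x) - exp (b * ?d x) + 1)"
      proof -
        have "exp (b * f x) = ?c k x * exp (b * ?d x)"
          by (simp add: algebra_simps flip: exp_add)
        then show ?thesis by (simp add: algebra_simps)
      qed
      also have "\<dots> \<le> ?c k x * ((?d x)\<^sup>2 * ?phi)"
        using le1[OF k x] b by (intro mult_left_mono entropy_function_scaling) auto
      finally show "?D k x \<le> ?phi * (?c k x * (?d x)\<^sup>2)"
        by (simp add: mult_ac)
    qed (use k in \<open>simp_all add: simps\<close>)
    also have "\<dots> = ?phi * (\<integral>x. ?c k x * (?d x)\<^sup>2 \<partial>PiM I M)"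
      by simp
    \<comment> \<open>The weight \<open>?c k\<close> is constant in coordinate \<open>k\<close>, so
      conditioning on the other coordinates turns the squared deviation into the conditional
      variance.\<close>
    also have "(\<integral>x. ?c k x * (?d x)\<^sup>2 \<partial>PiM I M) = (\<integral>x. cond_mean M k (\<lambda>x. ?c k x * (?d x)\<^sup>2) x \<partial>PiM I M)"
      using assms(1) k by (intro integral_cond_mean[symmetric]) (simp_all add: simps)
    also have "cond_mean M k (\<lambda>x. ?c k x * (?d x)\<^sup>2) = (\<lambda>x. ?c k x * cond_var M k f x)"
      by (rule ext) (simp add: cond_var_def cond_mean_def)
    also have "(\<integral>x. ?c k x * cond_var M k f x \<partial>PiM I M)
        \<le> (\<integral>x. cond_mean M k (\<lambda>x. exp (b * f x)) x * cond_var M k f x \<partial>PiM I M)"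
    proof (rule integral_mono)
      fix x assume x: "x \<in> space (PiM I M)"
      have "bdd_meas (M k) (\<lambda>y. b * f (x(k := y)))"
        using bdd_meas_upd_section[OF k assms(2) x] by (simp add: bdd_meas_simps)
      from prob_space.exp_expectation_le[OF prob this]
      show "?c k x * cond_var M k f x \<le> cond_mean M k (\<lambda>x. exp (b * f x)) x * cond_var M k f x"
        using cond_var_nonneg by (intro mult_right_mono) (auto simp: cond_mean_def)
    qed (use k in \<open>simp_all add: simps\<close>)
    \<comment> \<open>The conditional variance is constant in coordinate \<open>k\<close> too, so it
      moves inside the conditional mean and the tower property removes the conditioning.\<close>
    also have "\<dots> = (\<integral>x. cond_mean M k (\<lambda>x. exp (b * f x) * cond_var M k f x) x \<partial>PiM I M)"
      by (intro Bochner_Integration.integral_cong refl)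
        (simp add: cond_mean_def[of M k "\<lambda>x. exp (b * f x)"]
          cond_mean_def[of M k "\<lambda>x. exp (b * f x) * cond_var M k f x"])
    also have "\<dots> = (\<integral>x. exp (b * f x) * cond_var M k f x \<partial>PiM I M)"
      using assms(1) k by (intro integral_cond_mean) (simp_all add: simps)
    finally show ?thesis
      using phi by (simp add: mult_left_mono)
  qed
  have "(\<integral>x. exp (b * f x) * (b * f x) \<partial>PiM I M)
           - (\<integral>x. exp (b * f x) \<partial>PiM I M) * ln (\<integral>x. exp (b * f x) \<partial>PiM I M)
         \<le> (\<Sum>k\<in>I. \<integral>x. ?D k x \<partial>PiM I M)"
    using assms(1) by (intro entropy_subadditive[OF prob]) (simp_all add: simps)
  also have "\<dots> \<le> (\<Sum>k\<in>I. ?phi * (\<integral>x. exp (b * f x) * cond_var M k f x \<partial>PiM I M))"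
    by (intro sum_mono k)
  also have "\<dots> = ?phi * (\<integral>x. exp (b * f x) * (\<Sum>k\<in>I. cond_var M k f x) \<partial>PiM I M)"
    unfolding sum_distrib_left[symmetric]
    by (subst Bochner_Integration.integral_sum[symmetric]) (simp_all add: simps sum_distrib_left)
  finally show ?thesis .
qed

end

section \<open>The moment generating function and Herbst's argument\<close>

text \<open>Since \<open>f\<close> is bounded, the second-order remainder of
  \<open>exp (h * f x)\<close> is uniformly of order \<open>h\<^sup>2\<close>, so the difference
  quotient errs by at most a multiple of the absolute value of \<open>h\<close>.\<close>

lemma (in prob_space) has_derivative_expectation_exp:
  assumes f: "bdd_meas M f"
  shows "((\<lambda>b. expectation (\<lambda>x. exp (b * f x))) has_real_derivative
           expectation (\<lambda>x. exp (b * f x) * f x)) (at b)"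
proof -
  let ?F = "\<lambda>b. expectation (\<lambda>x. exp (b * f x))"
  let ?D = "expectation (\<lambda>x. exp (b * f x) * f x)"
  obtain B where B: "B > 0" "\<And>x. x \<in> space M \<Longrightarrow> \<bar>f x\<bar> \<le> B"
    using f by (rule bdd_measE) blast
  \<comment> \<open>The constant 2 is generous: \<open>(1 + z + 2 * z\<^sup>2) * (1 - z)\<close>
    equals \<open>1 + z\<^sup>2 * (1 - 2 * z)\<close>, which is at least 1 for
    \<open>z <= 1 / 2\<close>.\<close>
  have exp2: "\<bar>exp z - 1 - z\<bar> \<le> 2 * z\<^sup>2" if "\<bar>z\<bar> \<le> 1 / 2" for z :: real
  proof -
    have "exp z * (1 - z) \<le> 1"
      using mult_left_mono[OF exp_ge_add_one_self[of "-z"], of "exp z"] by (simp flip: exp_add)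
    moreover have "1 \<le> (1 + z + 2 * z\<^sup>2) * (1 - z)"
    proof -
      have "0 \<le> z\<^sup>2 * (1 - 2 * z)"
        using that by (intro mult_nonneg_nonneg) auto
      then show ?thesis by (simp add: algebra_simps power2_eq_square)
    qed
    ultimately have "exp z * (1 - z) \<le> (1 + z + 2 * z\<^sup>2) * (1 - z)" by linarith
    then have "exp z \<le> 1 + z + 2 * z\<^sup>2"
      using that by (simp add: mult_le_cancel_right)
    then show ?thesis
      using exp_ge_add_one_self[of z] zero_le_power2[of z] by linarith
  qed
  note simps = bdd_meas_integrable bdd_meas_simps f
  define C where "C = ?F b * (2 * B\<^sup>2)"
  \<comment> \<open>The radius \<open>1 / (2 * B)\<close> keeps \<open>h * f x\<close> within the
    range of \<open>exp2\<close>.\<close>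
  have bound: "\<bar>(?F (b + h) - ?F b) / h - ?D\<bar> \<le> C * \<bar>h\<bar>" if h: "h \<noteq> 0" "\<bar>h\<bar> < 1 / (2 * B)" for h
  proof -
    have "\<bar>?F (b + h) - ?F b - h * ?D\<bar> = \<bar>expectation (\<lambda>x. exp (b * f x) * (exp (h * f x) - 1 - h * f x))\<bar>"
      by (simp add: right_diff_distrib distrib_right exp_add simps mult.left_commute[of _ h])
    also have "\<dots> \<le> expectation (\<lambda>x. \<bar>exp (b * f x) * (exp (h * f x) - 1 - h * f x)\<bar>)"
      by (rule integral_abs_bound)
    also have "\<dots> \<le> expectation (\<lambda>x. exp (b * f x) * (2 * (h * B)\<^sup>2))"
    proof (rule integral_mono)
      fix x assume x: "x \<in> space M"
      have 1: "\<bar>h * f x\<bar> \<le> \<bar>h\<bar> * B"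
        using B(2)[OF x] by (simp add: abs_mult mult_left_mono)
      have 2: "\<bar>h\<bar> * B \<le> 1 / 2"
        using h B(1) by (simp add: field_simps)
      have "(h * f x)\<^sup>2 \<le> (h * B)\<^sup>2"
        using 1 B(1) by (simp add: abs_le_square_iff[symmetric] abs_mult)
      then have "\<bar>exp (h * f x) - 1 - h * f x\<bar> \<le> 2 * (h * B)\<^sup>2"
        using exp2[of "h * f x"] 1 2 by linarith
      then show "\<bar>exp (b * f x) * (exp (h * f x) - 1 - h * f x)\<bar> \<le> exp (b * f x) * (2 * (h * B)\<^sup>2)"
        by (simp add: abs_mult)
    qed (simp_all add: simps)
    also have "\<dots> = C * \<bar>h\<bar> * \<bar>h\<bar>"
      by (simp add: C_def power_mult_distrib power2_eq_square)
    finally have *: "\<bar>?F (b + h) - ?F b - h * ?D\<bar> \<le> C * \<bar>h\<bar> * \<bar>h\<bar>" .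
    have "(?F (b + h) - ?F b) / h - ?D = (?F (b + h) - ?F b - h * ?D) / h"
      using h by (simp add: field_simps)
    then show ?thesis
      using * h by (simp add: divide_le_eq)
  qed
  have "((\<lambda>h. (?F (b + h) - ?F b) / h - ?D) \<longlongrightarrow> 0) (at 0)"
  proof (rule Lim_null_comparison)
    show "((\<lambda>h. C * \<bar>h\<bar>) \<longlongrightarrow> 0) (at 0)"
      by (auto intro!: tendsto_eq_intros)
    have "1 / (2 * B) > 0" using B by simp
    then show "\<forall>\<^sub>F h in at 0. norm ((?F (b + h) - ?F b) / h - ?D) \<le> C * \<bar>h\<bar>"
      unfolding eventually_at using bound by (intro exI[of _ "1 / (2 * B)"]) (simp add: dist_real_def)
  qed
  then show ?thesis
    unfolding DERIV_def by (rule LIM_zero_cancel)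
qed

text \<open>
  Herbst's argument: the hypothesis says that \<open>ln F(b) / b - v (exp b - 1) / b\<close> is nonincreasing on
  \<open>b > 0\<close>, where \<open>F\<close> is the moment generating function; its limit at \<open>0\<close> is \<open>E f - v\<close>.
\<close>
lemma (in prob_space) ln_expectation_exp_le:
  assumes f: "bdd_meas M f"
    and ent: "\<And>b. b > 0 \<Longrightarrow>
      expectation (\<lambda>x. exp (b * f x) * (b * f x)) - expectation (\<lambda>x. exp (b * f x)) * ln (expectation (\<lambda>x. exp (b * f x)))
      \<le> (b * exp b - exp b + 1) * (v * expectation (\<lambda>x. exp (b * f x)))"
    and b: "b > 0"
  shows "ln (expectation (\<lambda>x. exp (b * f x))) \<le> b * expectation f + v * (exp b - 1 - b)"
proof -
  define F where "F b = expectation (\<lambda>x. exp (b * f x))" for b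
  define F' where "F' b = expectation (\<lambda>x. exp (b * f x) * f x)" for b
  have F: "(F has_real_derivative F' b) (at b)" for b
    unfolding F_def F'_def using f by (rule has_derivative_expectation_exp)
  have Fpos: "F b > 0" for b
    unfolding F_def using f by (intro bdd_meas_expectation_exp_pos) (simp add: bdd_meas_simps)
  have ent': "b * F' b - F b * ln (F b) \<le> (b * exp b - exp b + 1) * (v * F b)" if "b > 0" for b
    using ent[OF that] by (simp add: F_def F'_def mult.left_commute[of _ b])
  define K where "K b = ln (F b) / b - v * ((exp b - 1) / b)" for b
  have mono: "K b \<le> K a" if "0 < a" "a \<le> b" for a b
  proof (rule DERIV_nonpos_imp_nonincreasing[OF that(2)])
    fix s assume "a \<le> s" "s \<le> b"
    then have s: "s > 0" using that by simp
    let ?y = "(F' s / F s * s - ln (F s)) / s\<^sup>2 - v * ((exp s * s - (exp s - 1)) / s\<^sup>2)"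
    have "(K has_real_derivative ?y) (at s)"
      unfolding K_def using s Fpos[of s]
      by (auto intro!: derivative_eq_intros F simp: power2_eq_square) (simp add: algebra_simps)
    \<comment> \<open>The numerator of the derivative is the entropy hypothesis divided by
      \<open>F s\<close>.\<close>
    moreover have "?y \<le> 0"
    proof -
      have "F' s / F s * s - ln (F s) = (s * F' s - F s * ln (F s)) / F s"
        using Fpos[of s] by (simp add: field_simps)
      also have "\<dots> \<le> v * (exp s * s - (exp s - 1))"
      proof -
        have "s * F' s - F s * ln (F s) \<le> v * (exp s * s - (exp s - 1)) * F s"
          using ent'[OF s] by (simp add: algebra_simps)
        then show ?thesis
          using Fpos[of s] by (simp add: pos_divide_le_eq)
      qed
      finally have "F' s / F s * s - ln (F s) - v * (exp s * s - (exp s - 1)) \<le> 0" by simp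
      then have "(F' s / F s * s - ln (F s) - v * (exp s * s - (exp s - 1))) / s\<^sup>2 \<le> 0"
        by (rule divide_nonpos_nonneg) simp
      then show ?thesis
        using diff_divide_distrib[of "F' s / F s * s - ln (F s)" "v * (exp s * s - (exp s - 1))" "s\<^sup>2"]
        by (simp only: times_divide_eq_right)
    qed
    ultimately show "\<exists>y. (K has_real_derivative y) (at s) \<and> y \<le> 0" by blast
  qed
  have F0: "F 0 = 1" "F' 0 = expectation f"
    by (simp_all add: F_def F'_def prob_space)
  have "((\<lambda>b. ln (F b)) has_real_derivative expectation f) (at 0)"
    using F0 by (auto intro!: derivative_eq_intros F)
  \<comment> \<open>As \<open>ln (F 0) = 0\<close>, the quotient \<open>ln (F b) / b\<close> is the
    difference quotient of \<open>ln F\<close> at 0.\<close>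
  then have l1: "((\<lambda>b. ln (F b) / b) \<longlongrightarrow> expectation f) (at 0)"
    by (simp add: DERIV_def F0)
  have "(exp has_real_derivative 1) (at 0)"
    by (auto intro!: derivative_eq_intros)
  then have l2: "((\<lambda>b. (exp b - 1) / b) \<longlongrightarrow> (1::real)) (at 0)"
    by (simp add: DERIV_def)
  have "(K \<longlongrightarrow> expectation f - v * 1) (at 0)"
    unfolding K_def by (intro tendsto_intros l1 l2)
  then have "(K \<longlongrightarrow> expectation f - v) (at_right 0)"
    by (simp add: filterlim_at_split)
  moreover have "\<forall>\<^sub>F a in at_right 0. K b \<le> K a"
    using b by (auto simp: eventually_at_right intro!: exI[of _ b] mono)
  ultimately have "K b \<le> expectation f - v"
    by (intro tendsto_lowerbound) auto
  then show ?thesis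
    using b by (simp add: K_def F_def field_simps)
qed

section \<open>From exponential moments to tail bounds\<close>

text \<open>Solving the inequality for the logarithm gives the rational lower bound subtracted in
  \<open>q\<close>. Both vanish at 0, and the derivative of \<open>q\<close> simplifies to
  \<open>s ^ 3 / ((s + 3)\<^sup>2 * (1 + s)\<^sup>2)\<close>.\<close>

lemma Bennett_ge_Bernstein:
  fixes u :: real
  assumes "u \<ge> 0"
  shows "u\<^sup>2 / (2 + 2 * u / 3) \<le> (1 + u) * ln (1 + u) - u"
proof -
  define q where "q s = ln (1 + s) - (5 * s\<^sup>2 + 6 * s) / (2 * (s + 3) * (1 + s))" for s :: real
  have "q 0 \<le> q u"
  proof (rule DERIV_nonneg_imp_nondecreasing[OF assms])
    fix s :: real assume s: "0 \<le> s" "s \<le> u"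
    define N where "N = (10 * s + 6) * (2 * (s + 3) * (1 + s)) - (5 * s\<^sup>2 + 6 * s) * (2 * (1 + s) + 2 * (s + 3))"
    define D where "D = (2 * (s + 3) * (1 + s))\<^sup>2"
    have "(q has_real_derivative 1 / (1 + s) - N / D) (at s)"
      unfolding q_def N_def D_def using s
      by (auto intro!: derivative_eq_intros simp: power2_eq_square)
    moreover have "N / D \<le> 1 / (1 + s)"
    proof -
      have "D - N * (1 + s) = 4 * (s ^ 3 * (1 + s))"
        by (simp add: N_def D_def algebra_simps power2_eq_square power3_eq_cube)
      moreover have "4 * (s ^ 3 * (1 + s)) \<ge> 0"
        using s by simp
      ultimately have "N * (1 + s) \<le> D" by linarith
      moreover have "D > 0"
        using s by (simp add: D_def)
      ultimately show ?thesis
        using s by (simp add: field_simps)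
    qed
    ultimately show "\<exists>y. (q has_real_derivative y) (at s) \<and> 0 \<le> y"
      by (intro exI[of _ "1 / (1 + s) - N / D"]) auto
  qed
  then have "(5 * u\<^sup>2 + 6 * u) / (2 * (u + 3) * (1 + u)) \<le> ln (1 + u)"
    by (simp add: q_def)
  then have "(1 + u) * ((5 * u\<^sup>2 + 6 * u) / (2 * (u + 3) * (1 + u))) \<le> (1 + u) * ln (1 + u)"
    using assms by (intro mult_left_mono) auto
  moreover have "(1 + u) * ((5 * u\<^sup>2 + 6 * u) / (2 * (u + 3) * (1 + u))) = (5 * u\<^sup>2 + 6 * u) / (2 * (u + 3))"
    using assms by simp
  moreover have "(5 * u\<^sup>2 + 6 * u) / (2 * (u + 3)) = u\<^sup>2 / (2 + 2 * u / 3) + u"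
    using assms by (simp add: field_simps power2_eq_square)
  ultimately show ?thesis by simp
qed

text \<open>The essential supremum lies between 0 and a pointwise bound, so it is finite and
  \<open>real_of_ereal\<close> does not fall back on its default value 0.\<close>

lemma (in prob_space) AE_le_Linf_norm:
  assumes g: "bdd_meas M g"
  shows "AE x in M. \<bar>g x\<bar> \<le> Linf_norm M g" and "Linf_norm M g \<ge> 0"
proof -
  obtain B where B: "\<And>x. x \<in> space M \<Longrightarrow> \<bar>g x\<bar> \<le> B"
    using g by (rule bdd_measE) blast
  let ?s = "esssup M (\<lambda>x. ereal \<bar>g x\<bar>)"
  have le: "AE x in M. ereal \<bar>g x\<bar> \<le> ?s"
    by (rule esssup_AE)
  have "?s \<le> ereal B"
    using B bdd_measD[OF g] by (intro esssup_I AE_I2) auto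
  moreover have "?s \<ge> 0"
  proof -
    have "AE x in M. 0 \<le> ?s"
      using le by eventually_elim (auto intro: order_trans[of 0 "ereal \<bar>g _\<bar>"])
    then show ?thesis by simp
  qed
  ultimately obtain r where r: "?s = ereal r" "r \<ge> 0"
    by (cases ?s) auto
  then have "Linf_norm M g = r"
    by (simp add: Linf_norm_def)
  then show "AE x in M. \<bar>g x\<bar> \<le> Linf_norm M g" and "Linf_norm M g \<ge> 0"
    using le r by auto
qed

text \<open>Markov's inequality for \<open>exp (b * f)\<close>, with the moment generating function
  moved into the exponent to meet Herbst's bound.\<close>

lemma (in prob_space) Chernoff_bound:
  assumes f: "bdd_meas M f" and "b > 0"
  shows "prob {x \<in> space M. f x - expectation f > t}
    \<le> exp (ln (expectation (\<lambda>x. exp (b * f x))) - b * expectation f - b * t)"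
proof -
  have bf: "bdd_meas M (\<lambda>x. b * f x)"
    using f by (simp add: bdd_meas_simps)
  note [measurable] = bdd_measD[OF f]
  let ?c = "exp (b * expectation f + b * t)"
  have "prob {x \<in> space M. f x - expectation f > t} \<le> prob {x \<in> space M. exp (b * f x) \<ge> ?c}"
  proof (rule finite_measure_mono)
    show "{x \<in> space M. f x - expectation f > t} \<subseteq> {x \<in> space M. exp (b * f x) \<ge> ?c}"
    proof
      fix x assume x: "x \<in> {x \<in> space M. f x - expectation f > t}"
      then have "b * (expectation f + t) \<le> b * f x"
        using \<open>b > 0\<close> by (intro mult_left_mono) auto
      with x show "x \<in> {x \<in> space M. exp (b * f x) \<ge> ?c}" by (simp add: algebra_simps)
    qed
  qed measurable
  also have "\<dots> \<le> expectation (\<lambda>x. exp (b * f x)) / ?c"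
    using bf by (intro integral_Markov_inequality_measure[where A = "{}"])
      (auto intro: bdd_meas_integrable bdd_meas_exp)
  also have "\<dots> = exp (ln (expectation (\<lambda>x. exp (b * f x))) - b * expectation f - b * t)"
    using bdd_meas_expectation_exp_pos[OF bf] by (simp add: exp_diff exp_add)
  finally show ?thesis .
qed

text \<open>Replacing the sum of conditional variances by \<open>V\<close> under the weight
  \<open>exp (b * f)\<close> gives the hypothesis of Herbst's argument. The parameter
  \<open>b\<close> stays free because its choice depends on whether \<open>V\<close> is
  zero.\<close>

lemma prob_deviation_le:
  fixes M :: "nat \<Rightarrow> 'a measure"
  assumes prob: "\<And>i. prob_space (M i)" and "finite I" and f: "bdd_meas (PiM I M) f"
    and "\<And>k x. k \<in> I \<Longrightarrow> x \<in> space (PiM I M) \<Longrightarrow> f x - cond_mean M k f x \<le> 1"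
    and V: "V = Linf_norm (PiM I M) (\<lambda>x. \<Sum>k\<in>I. cond_var M k f x)"
    and b: "b > 0"
  shows "measure (PiM I M) {x \<in> space (PiM I M). f x - (\<integral>z. f z \<partial>PiM I M) > t}
    \<le> exp (V * (exp b - 1 - b) - b * t)"
proof -
  interpret P: prob_space "PiM I M" by (rule prob_space_PiM[OF prob])
  let ?S = "\<lambda>x. \<Sum>k\<in>I. cond_var M k f x"
  have S: "bdd_meas (PiM I M) ?S"
    by (intro bdd_meas_sum bdd_meas_cond_var[OF prob _ f])
  have "P.expectation (\<lambda>x. exp (b * f x) * (b * f x))
      - P.expectation (\<lambda>x. exp (b * f x)) * ln (P.expectation (\<lambda>x. exp (b * f x)))
      \<le> (b * exp b - exp b + 1) * (V * P.expectation (\<lambda>x. exp (b * f x)))" if "b > 0" for b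
  proof -
    have phi: "b * exp b - exp b + 1 \<ge> 0"
      by (rule entropy_function_nonneg)
    have "P.expectation (\<lambda>x. exp (b * f x) * ?S x) \<le> P.expectation (\<lambda>x. V * exp (b * f x))"
    proof (rule integral_mono_AE)
      show "AE x in PiM I M. exp (b * f x) * ?S x \<le> V * exp (b * f x)"
        using P.AE_le_Linf_norm(1)[OF S] unfolding V[symmetric] by eventually_elim (simp add: abs_le_iff)
    qed (simp_all add: P.bdd_meas_integrable bdd_meas_simps f S)
    then have "(b * exp b - exp b + 1) * P.expectation (\<lambda>x. exp (b * f x) * ?S x)
        \<le> (b * exp b - exp b + 1) * (V * P.expectation (\<lambda>x. exp (b * f x)))"
      using phi by (intro mult_left_mono) simp_all
    with entropy_le_cond_var[OF prob assms(2) f assms(4), of b] that show ?thesis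
      by simp
  qed
  from P.ln_expectation_exp_le[OF f this b]
  have "ln (P.expectation (\<lambda>x. exp (b * f x))) - b * P.expectation f - b * t
      \<le> V * (exp b - 1 - b) - b * t"
    by simp
  then show ?thesis
    using P.Chernoff_bound[OF f b, of t] by (meson exp_le_cancel_iff order_trans)
qed

theorem theorem11:
  fixes n :: nat
    and M :: "nat \<Rightarrow> 'a measure"
    and f :: "(nat \<Rightarrow> 'a) \<Rightarrow> real"
    and t V :: real
  assumes "\<And>k. k \<in> {1..n} \<Longrightarrow> prob_space (M k)"
    and "f \<in> borel_measurable (Pi\<^sub>M {1..n} M)"
    and "\<exists>B. \<forall>x \<in> space (Pi\<^sub>M {1..n} M). \<bar>f x\<bar> \<le> B"
    and "\<And>k x. k \<in> {1..n} \<Longrightarrow> x \<in> space (Pi\<^sub>M {1..n} M) \<Longrightarrow> f x - cond_mean M k f x \<le> 1"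
    and "t > 0"
    and "V = Linf_norm (Pi\<^sub>M {1..n} M) (sum_cond_var M n f)"
  shows "measure (Pi\<^sub>M {1..n} M)
           {x \<in> space (Pi\<^sub>M {1..n} M). f x - (\<integral>z. f z \<partial>(Pi\<^sub>M {1..n} M)) > t}
         \<le> (if V = 0 then 0 else exp (- V * ((1 + t / V) * ln (1 + t / V) - t / V)))
       \<and> (if V = 0 then 0 else exp (- V * ((1 + t / V) * ln (1 + t / V) - t / V)))
         \<le> exp (- (t\<^sup>2) / (2 * V + 2 * t / 3))"
proof -
  \<comment> \<open>The auxiliary lemmas want every \<open>M k\<close> to be a probability space, not only those with \<open>k \<in> {1..n}\<close>.\<close>
  define M' where "M' k = (if k \<in> {1..n} then M k else return (count_space UNIV) undefined)" for k
  have prob: "prob_space (M' k)" for k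
    using assms(1) by (auto simp: M'_def intro: prob_space_return)
  have P: "PiM {1..n} M' = PiM {1..n} M"
    by (rule PiM_cong) (auto simp: M'_def)
  have mean: "cond_mean M' k g = cond_mean M k g" if "k \<in> {1..n}" for k g
    using that by (simp add: cond_mean_def[abs_def] M'_def)
  have var: "cond_var M' k f = cond_var M k f" if "k \<in> {1..n}" for k
    using that by (simp add: cond_var_def mean)
  have sum: "sum_cond_var M n f = (\<lambda>x. \<Sum>k\<in>{1..n}. cond_var M' k f x)"
    by (auto simp: sum_cond_var_def fun_eq_iff var)
  have f: "bdd_meas (PiM {1..n} M') f"
    unfolding bdd_meas_def P using assms(2,3) by blast
  interpret P: prob_space "PiM {1..n} M'" by (rule prob_space_PiM[OF prob])
  have V0: "V \<ge> 0"
    unfolding assms(6) sum P[symmetric]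
    by (intro P.AE_le_Linf_norm(2) bdd_meas_sum bdd_meas_cond_var[OF prob _ f])
  let ?p = "measure (Pi\<^sub>M {1..n} M) {x \<in> space (Pi\<^sub>M {1..n} M). f x - (\<integral>z. f z \<partial>(Pi\<^sub>M {1..n} M)) > t}"
  have bound: "?p \<le> exp (V * (exp b - 1 - b) - b * t)" if "b > 0" for b
    unfolding P[symmetric]
  proof (rule prob_deviation_le[OF prob _ f _ _ that])
    show "f x - cond_mean M' k f x \<le> 1" if "k \<in> {1..n}" "x \<in> space (PiM {1..n} M')" for k x
      using assms(4) that unfolding P mean[OF that(1)] by blast
    show "V = Linf_norm (PiM {1..n} M') (\<lambda>x. \<Sum>k\<in>{1..n}. cond_var M' k f x)"
      unfolding P using assms(6) by (simp only: sum)
  qed simp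
  show ?thesis
  proof (cases "V = 0")
    case True
    \<comment> \<open>With \<open>V = 0\<close> the bound is \<open>exp (- (b * t))\<close> for
      every positive \<open>b\<close>, which forces the probability to be 0.\<close>
    have "((\<lambda>b. exp (- (b * t))) \<longlongrightarrow> 0) at_top"
      using \<open>t > 0\<close> by real_asymp
    moreover have "\<forall>\<^sub>F b in at_top. ?p \<le> exp (- (b * t))"
      using eventually_gt_at_top[of 0] by eventually_elim (use bound True in auto)
    ultimately have "?p \<le> 0"
      by (intro tendsto_lowerbound) auto
    then show ?thesis using True by simp
  next
    case False
    with V0 have V: "V > 0" by simp
    define u where "u = t / V"
    have u: "u > 0" and t: "t = V * u"
      using V \<open>t > 0\<close> by (simp_all add: u_def)
    \<comment> \<open>The value \<open>ln (1 + u)\<close> minimises the exponent: the derivative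
      \<open>V * (exp b - 1) - t\<close> vanishes there.\<close>
    have "V * (exp (ln (1 + u)) - 1 - ln (1 + u)) - ln (1 + u) * t = - V * ((1 + u) * ln (1 + u) - u)"
      using u by (simp add: t algebra_simps)
    then have 1: "?p \<le> exp (- V * ((1 + u) * ln (1 + u) - u))"
      using bound[of "ln (1 + u)"] u by simp
    have "V * (u\<^sup>2 / (2 + 2 * u / 3)) \<le> V * ((1 + u) * ln (1 + u) - u)"
      using V u by (intro mult_left_mono Bennett_ge_Bernstein) auto
    \<comment> \<open>Substituting \<open>t = V * u\<close> extracts a common factor
      \<open>V\<close>, leaving the one-variable inequality.\<close>
    moreover have "t\<^sup>2 / (2 * V + 2 * t / 3) = V * (u\<^sup>2 / (2 + 2 * u / 3))"
    proof -
      have "2 * V + 2 * t / 3 = V * (2 + 2 * u / 3)"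
        by (simp add: t algebra_simps)
      then show ?thesis
        using V by (simp add: t power2_eq_square)
    qed
    ultimately have 2: "exp (- V * ((1 + u) * ln (1 + u) - u)) \<le> exp (- (t\<^sup>2) / (2 * V + 2 * t / 3))"
      by simp
    show ?thesis
      using 1 2 False by (simp add: u_def)
  qed
qed

end
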